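(* $F_{\mathrm{strong}}\not\preceq\mathrm{WL}_{3/2}$: there exist graphs $G$ and $H$ with $\mathrm{WL}_{3/2}(G)=\mathrm{WL}_{3/2}(H)$ but $F_{\mathrm{strong}}(G)\ne F_{\mathrm{strong}}(H)$. Consequently also $F_{\mathrm{weak}}$ is strictly weaker than $F_{\mathrm{strong}}$ (there are graphs with equal $F_{\mathrm{weak}}$ and different $F_{\mathrm{strong}}$).
   Context: Graphs are finite, simple and undirected with adjacency matrix $A$. $\mathrm{Spec}(G)$ is the multiset of eigenvalues of $A$. Let $\mu_1<\dots<\mu_m$ be the distinct eigenvalues, $P_i$ the orthogonal projection matrix onto the eigenspace of $\mu_i$, $P_*(x,y)=(P_1(x,y),\dots,P_m(x,y))$. Fürer's strong spectral invariant is $F_{\mathrm{strong}}(G)=\big(\mathrm{Spec}(G),\{\!\{(P_*(x,x),\{\!\{(P_*(x,y),P_*(y,y))\}\!\}_{y\in V(G)})\}\!\}_{x\in V(G)}\big)$ and the weak one is $F_{\mathrm{weak}}(G)=\big(\mathrm{Spec}(G),\{\!\{(P_*(x,x),\{\!\{P_*(x,y)\}\!\}_{y})\}\!\}_{x}\big)$, where $\{\!\{\cdot\}\!\}$ denotes a multiset. Color refinement (1-WL) on a vertex-colored $n$-vertex graph: $C^0(x)$ is the color of $x$ (uniform if uncolored), $C^{r+1}(x)=\big(C^r(x),\{\!\{C^r(y)\}\!\}_{y\in N(x)}\big)$; $\mathrm{WL}_1(G)=\{\!\{C^n(x)\}\!\}_{x\in V(G)}$. $G_x$ is $G$ with vertex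 $x$ individualized (given a special new color, the same for all choices of $x$). $\mathrm{WL}_{3/2}(G)=\{\!\{\mathrm{WL}_1(G_x)\}\!\}_{x\in V(G)}$. *)

theory Defs
  imports "Jordan_Normal_Form.Char_Poly" "HOL-Library.Multiset"
begin

text \<open>A finite simple graph on the vertex set {0..<n}: a pair (n, E) where the
  adjacency relation E is symmetric and irreflexive on {0..<n}
  (values of E outside {0..<n} are irrelevant to all invariants below).\<close>

type_synonym graph = "nat \<times> (nat \<Rightarrow> nat \<Rightarrow> bool)"

definition is_graph :: "graph \<Rightarrow> bool" where
  "is_graph G = (\<forall>x<fst G. \<forall>y<fst G. (snd G x y \<longleftrightarrow> snd G y x) \<and> \<not> snd G x x)"

definition verts :: "graph \<Rightarrow> nat set" where
  "verts G = {0..<fst G}"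

definition nbrs :: "graph \<Rightarrow> nat \<Rightarrow> nat set" where
  "nbrs G x = {y \<in> verts G. snd G x y}"

definition adj_mat :: "graph \<Rightarrow> real mat" where
  "adj_mat G = mat (fst G) (fst G) (\<lambda>(i, j). if snd G i j then 1 else 0)"

definition Spec :: "graph \<Rightarrow> real multiset" where
  "Spec G = proots (char_poly (adj_mat G))"

definition distinct_eigs :: "graph \<Rightarrow> real list" where
  "distinct_eigs G = sorted_list_of_set (set_mset (Spec G))"

definition eigenspace :: "graph \<Rightarrow> real \<Rightarrow> real vec set" where
  "eigenspace G \<mu> = {v \<in> carrier_vec (fst G). adj_mat G *\<^sub>v v = \<mu> \<cdot>\<^sub>v v}"

definition eig_proj :: "graph \<Rightarrow> real \<Rightarrow> real mat" where
  "eig_proj G \<mu> = (THE P. P \<in> carrier_mat (fst G) (fst G) \<and>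
     (\<forall>v \<in> carrier_vec (fst G). P *\<^sub>v v \<in> eigenspace G \<mu> \<and>
        (\<forall>w \<in> eigenspace G \<mu>. (v - P *\<^sub>v v) \<bullet> w = 0)))"

definition Pstar :: "graph \<Rightarrow> nat \<Rightarrow> nat \<Rightarrow> real list" where
  "Pstar G x y = map (\<lambda>\<mu>. eig_proj G \<mu> $$ (x, y)) (distinct_eigs G)"

definition F_strong :: "graph \<Rightarrow> real multiset \<times> (real list \<times> (real list \<times> real list) multiset) multiset" where
  "F_strong G = (Spec G,
     image_mset (\<lambda>x. (Pstar G x x, image_mset (\<lambda>y. (Pstar G x y, Pstar G y y)) (mset_set (verts G))))
       (mset_set (verts G)))"

definition F_weak :: "graph \<Rightarrow> real multiset \<times> (real list \<times> real list multiset) multiset" where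
  "F_weak G = (Spec G,
     image_mset (\<lambda>x. (Pstar G x x, image_mset (\<lambda>y. Pstar G x y) (mset_set (verts G))))
       (mset_set (verts G)))"

datatype color = Init nat | Refine color "color multiset"

fun cr_color :: "graph \<Rightarrow> (nat \<Rightarrow> nat) \<Rightarrow> nat \<Rightarrow> nat \<Rightarrow> color" where
  "cr_color G c 0 x = Init (c x)"
| "cr_color G c (Suc r) x =
     Refine (cr_color G c r x) (image_mset (cr_color G c r) (mset_set (nbrs G x)))"

definition WL1 :: "graph \<Rightarrow> (nat \<Rightarrow> nat) \<Rightarrow> color multiset" where
  "WL1 G c = image_mset (cr_color G c (fst G)) (mset_set (verts G))"

definition indiv :: "nat \<Rightarrow> nat \<Rightarrow> nat" where
  "indiv x = (\<lambda>y. if y = x then 1 else 0)"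

definition WL32 :: "graph \<Rightarrow> color multiset multiset" where
  "WL32 G = image_mset (\<lambda>x. WL1 G (indiv x)) (mset_set (verts G))"

end

theory Submission
  imports Defs
begin

text \<open>Both graphs are made of four 3-regular units on 6 vertices, two copies of \<open>K\<^bsub>3,3\<^esub>\<close> and two triangular
  prisms, joined completely in two pairs. In one graph the pairs consist of isomorphic units, in the other one
  they are mixed. After individualizing a vertex, color refinement recognizes the type of its unit, but sees all
  other units just as 3-regular graphs, so \<open>WL32\<close> does not notice how the units are paired. The same is true for
  the entries \<open>P\<^sub>*(x, y)\<close> with fixed \<open>x\<close>. The diagonal entries \<open>P\<^sub>*(y, y)\<close>, however, reveal the type of the unit
  of \<open>y\<close>, and \<open>P\<^sub>*(x, y)\<close> reveals whether \<open>x\<close> and \<open>y\<close> lie in the same pair. All eigenvalues are integers, which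
  makes the projections explicit.\<close>

section \<open>Color refinement and equitable labelings\<close>

text \<open>Equal images amount to a matching of \<open>M\<close> with \<open>N\<close> along which
  \<open>p\<close> and \<open>q\<close> agree; by the second assumption \<open>f\<close> and
  \<open>g\<close> agree along the same matching. It serves whenever labels determine an
  invariant.\<close>

lemma image_mset_eq_if_refines:
  assumes "image_mset p M = image_mset q N"
    and "\<And>a b. a \<in># M \<Longrightarrow> b \<in># N \<Longrightarrow> p a = q b \<Longrightarrow> f a = g b"
  shows "image_mset f M = image_mset g N"
proof -
  have "rel_mset (=) (image_mset p M) (image_mset q N)"
    using assms(1) by (simp add: multiset.rel_eq)
  then have "rel_mset (\<lambda>a b. p a = q b) M N"
    by (simp add: multiset.rel_map)
  then have "rel_mset (\<lambda>a b. f a = g b) M N"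
    by (rule multiset.rel_mono_strong) (use assms(2) in auto)
  then have "rel_mset (=) (image_mset f M) (image_mset g N)"
    by (simp add: multiset.rel_map)
  then show ?thesis
    by (simp add: multiset.rel_eq)
qed

lemma finite_verts [simp]: "finite (verts G)"
  by (simp add: verts_def)

lemma finite_nbrs [simp]: "finite (nbrs G x)"
  by (simp add: nbrs_def)

lemma nbrs_subset_verts: "y \<in> nbrs G x \<Longrightarrow> y \<in> verts G"
  by (simp add: nbrs_def)

text \<open>\<open>p\<close> and \<open>q\<close> form a joint equitable labeling of the two graphs.
  It is at least as fine as every round of refinement: in the induction, equal label counts among
  neighbors give equal color counts.\<close>

lemma cr_color_eq_if_equitable:
  assumes init: "\<And>x y. x \<in> verts G \<Longrightarrow> y \<in> verts H \<Longrightarrow> p x = q y \<Longrightarrow> c x = d y"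
    and equitable: "\<And>x y. x \<in> verts G \<Longrightarrow> y \<in> verts H \<Longrightarrow> p x = q y \<Longrightarrow>
      image_mset p (mset_set (nbrs G x)) = image_mset q (mset_set (nbrs H y))"
    and "x \<in> verts G" "y \<in> verts H" "p x = q y"
  shows "cr_color G c r x = cr_color H d r y"
  using assms(3-5)
proof (induction r arbitrary: x y)
  case 0
  then show ?case using init by simp
next
  case (Suc r)
  have "image_mset (cr_color G c r) (mset_set (nbrs G x)) =
        image_mset (cr_color H d r) (mset_set (nbrs H y))"
    using equitable[OF Suc.prems] Suc.IH
    by (elim image_mset_eq_if_refines) (auto dest: nbrs_subset_verts)
  then show ?case using Suc by simp
qed

lemma WL1_eq_if_equitable:
  assumes "\<And>x y. x \<in> verts G \<Longrightarrow> y \<in> verts H \<Longrightarrow> p x = q y \<Longrightarrow> c x = d y"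
    and "\<And>x y. x \<in> verts G \<Longrightarrow> y \<in> verts H \<Longrightarrow> p x = q y \<Longrightarrow>
      image_mset p (mset_set (nbrs G x)) = image_mset q (mset_set (nbrs H y))"
    and "fst G = fst H"
    and "image_mset p (mset_set (verts G)) = image_mset q (mset_set (verts H))"
  shows "WL1 G c = WL1 H d"
  unfolding WL1_def using assms(4)
proof (rule image_mset_eq_if_refines)
  fix x y assume "x \<in># mset_set (verts G)" "y \<in># mset_set (verts H)" "p x = q y"
  then show "cr_color G c (fst G) x = cr_color H d (fst H) y"
    unfolding assms(3)
    by (intro cr_color_eq_if_equitable[where p = p and q = q]) (simp_all add: assms(1,2))
qed

section \<open>Eigenprojections from a resolution of the identity\<close>

lemma adj_mat_carrier [simp]: "adj_mat G \<in> carrier_mat (fst G) (fst G)"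
  by (simp add: adj_mat_def)

lemma transpose_adj_mat:
  assumes "is_graph G"
  shows "transpose_mat (adj_mat G) = adj_mat G"
  using assms by (intro eq_matI) (auto simp: adj_mat_def is_graph_def)

lemma eigenspaces_orthogonal:
  assumes "is_graph G" "v \<in> eigenspace G \<mu>" "w \<in> eigenspace G \<nu>" "\<mu> \<noteq> \<nu>"
  shows "v \<bullet> w = 0"
proof -
  have v: "v \<in> carrier_vec (fst G)" "adj_mat G *\<^sub>v v = \<mu> \<cdot>\<^sub>v v"
    and w: "w \<in> carrier_vec (fst G)" "adj_mat G *\<^sub>v w = \<nu> \<cdot>\<^sub>v w"
    using assms by (auto simp: eigenspace_def)
  have "(transpose_mat (adj_mat G) *\<^sub>v v) \<bullet> w = v \<bullet> (adj_mat G *\<^sub>v w)"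
    using v(1) w(1) by (intro transpose_vec_mult_scalar) auto
  then have "\<mu> * (v \<bullet> w) = \<nu> * (v \<bullet> w)"
    using v w by (simp add: transpose_adj_mat[OF assms(1)])
  then show ?thesis using assms(4) by simp
qed

lemma real_scalar_prod_self_eq_0D:
  fixes v :: "real vec"
  assumes "v \<in> carrier_vec n" "v \<bullet> v = 0"
  shows "v = 0\<^sub>v n"
proof (rule eq_vecI)
  fix i assume "i < dim_vec (0\<^sub>v n :: real vec)"
  moreover have "(\<Sum>i\<in>{0..<n}. v $ i * v $ i) = 0"
    using assms by (simp add: scalar_prod_def)
  ultimately show "v $ i = 0\<^sub>v n $ i"
    by (subst (asm) sum_nonneg_eq_0_iff) auto
qed (use assms in auto)

lemma eig_proj_eqI:
  assumes "P \<in> carrier_mat (fst G) (fst G)"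
    and P: "\<And>v. v \<in> carrier_vec (fst G) \<Longrightarrow> P *\<^sub>v v \<in> eigenspace G \<mu>"
    and orth: "\<And>v w. v \<in> carrier_vec (fst G) \<Longrightarrow> w \<in> eigenspace G \<mu> \<Longrightarrow> (v - P *\<^sub>v v) \<bullet> w = 0"
  shows "eig_proj G \<mu> = P"
  unfolding eig_proj_def
proof (rule the_equality)
  show "P \<in> carrier_mat (fst G) (fst G) \<and> (\<forall>v\<in>carrier_vec (fst G). P *\<^sub>v v \<in> eigenspace G \<mu> \<and>
      (\<forall>w\<in>eigenspace G \<mu>. (v - P *\<^sub>v v) \<bullet> w = 0))"
    using assms by blast
next
  let ?n = "fst G"
  fix Q
  assume Q: "Q \<in> carrier_mat ?n ?n \<and> (\<forall>v\<in>carrier_vec ?n. Q *\<^sub>v v \<in> eigenspace G \<mu> \<and>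
      (\<forall>w\<in>eigenspace G \<mu>. (v - Q *\<^sub>v v) \<bullet> w = 0))"
  have eq: "Q *\<^sub>v v = P *\<^sub>v v" if v: "v \<in> carrier_vec ?n" for v
  proof -
    define p q where "p = P *\<^sub>v v" and "q = Q *\<^sub>v v"
    have p: "p \<in> eigenspace G \<mu>" and q: "q \<in> eigenspace G \<mu>"
      using P Q v by (auto simp: p_def q_def)
    then have pc: "p \<in> carrier_vec ?n" "adj_mat G *\<^sub>v p = \<mu> \<cdot>\<^sub>v p"
      and qc: "q \<in> carrier_vec ?n" "adj_mat G *\<^sub>v q = \<mu> \<cdot>\<^sub>v q"
      by (simp_all add: eigenspace_def)
    have "adj_mat G *\<^sub>v (q - p) = \<mu> \<cdot>\<^sub>v (q - p)"
      using pc qc mult_minus_distrib_mat_vec[OF adj_mat_carrier qc(1) pc(1)]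
      by (auto simp: right_diff_distrib)
    then have d: "q - p \<in> eigenspace G \<mu>"
      using pc qc by (simp add: eigenspace_def)
    have dc: "q - p \<in> carrier_vec ?n" using pc qc by simp
    \<comment> \<open>Both \<open>v - p\<close> and \<open>v - q\<close> are orthogonal to the
      eigenspace, which contains \<open>q - p\<close>; so \<open>q - p\<close> is orthogonal to
      itself.\<close>
    have "q - p = (v - p) - (v - q)"
      using v pc qc by (intro eq_vecI) auto
    then have "(q - p) \<bullet> (q - p) = ((v - p) - (v - q)) \<bullet> (q - p)"
      by simp
    also have "\<dots> = (v - p) \<bullet> (q - p) - (v - q) \<bullet> (q - p)"
      using v pc qc dc by (intro minus_scalar_prod_distrib[of _ ?n]) auto
    also have "\<dots> = 0" using orth[OF v] Q v d by (simp add: p_def q_def)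
    finally have "q - p = 0\<^sub>v ?n"
      using dc by (intro real_scalar_prod_self_eq_0D)
    then have "(q - p) $ i = 0" if "i < ?n" for i
      using that by simp
    then show ?thesis
      using pc(1) qc(1) by (intro eq_vecI) (auto simp flip: p_def q_def)
  qed
  show "Q = P"
  proof (rule eq_matI)
    fix i j assume "i < dim_row P" "j < dim_col P"
    then show "Q $$ (i, j) = P $$ (i, j)"
      using arg_cong[OF eq[of "unit_vec ?n j"], of "\<lambda>v. v $ i"] assms(1) Q by auto
  qed (use assms(1) Q in auto)
qed

text \<open>Conditions that can be checked entrywise on explicit matrices. They suffice because
  eigenspaces of a symmetric matrix are orthogonal: the sum over \<open>M\<close> splits every
  vector into its orthogonal components. Some \<open>P \<mu>\<close> may still vanish, which
  \<open>set_Spec\<close> excludes.\<close>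

locale spectral_resolution =
  fixes G :: graph and M :: "real set" and P :: "real \<Rightarrow> nat \<Rightarrow> nat \<Rightarrow> real"
  assumes graph: "is_graph G" and fin: "finite M"
    and eig: "\<And>\<mu> x y. \<mu> \<in> M \<Longrightarrow> x < fst G \<Longrightarrow> y < fst G \<Longrightarrow>
      (\<Sum>k<fst G. (if snd G x k then 1 else 0) * P \<mu> k y) = \<mu> * P \<mu> x y"
    and resolution: "\<And>x y. x < fst G \<Longrightarrow> y < fst G \<Longrightarrow> (\<Sum>\<mu>\<in>M. P \<mu> x y) = (if x = y then 1 else 0)"
begin

abbreviation "Pmat \<mu> \<equiv> mat (fst G) (fst G) (\<lambda>(x, y). P \<mu> x y)"

lemma Pmat_eigen:
  assumes "\<mu> \<in> M"
  shows "adj_mat G * Pmat \<mu> = \<mu> \<cdot>\<^sub>m Pmat \<mu>"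
  using eig[OF assms]
  by (intro eq_matI) (auto simp: adj_mat_def scalar_prod_def atLeast0LessThan)

lemma Pmat_in_eigenspace:
  assumes "\<mu> \<in> M" "v \<in> carrier_vec (fst G)"
  shows "Pmat \<mu> *\<^sub>v v \<in> eigenspace G \<mu>"
proof -
  have "adj_mat G *\<^sub>v (Pmat \<mu> *\<^sub>v v) = (adj_mat G * Pmat \<mu>) *\<^sub>v v"
    using assms by (simp add: assoc_mult_mat_vec[of _ "fst G" "fst G" _ "fst G"])
  also have "\<dots> = \<mu> \<cdot>\<^sub>v (Pmat \<mu> *\<^sub>v v)"
    using assms by (auto intro!: eq_vecI simp: Pmat_eigen)
  finally show ?thesis
    using mult_mat_vec_carrier[OF mat_carrier assms(2)] by (simp add: eigenspace_def)
qed

lemma sum_Pmat_mult_vec: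
  assumes "v \<in> carrier_vec (fst G)" "x < fst G"
  shows "(\<Sum>\<mu>\<in>M. (Pmat \<mu> *\<^sub>v v) $ x) = v $ x"
proof -
  have "(\<Sum>\<mu>\<in>M. (Pmat \<mu> *\<^sub>v v) $ x) = (\<Sum>\<mu>\<in>M. \<Sum>y<fst G. P \<mu> x y * v $ y)"
    using assms by (simp add: scalar_prod_def atLeast0LessThan)
  also have "\<dots> = (\<Sum>y<fst G. (\<Sum>\<mu>\<in>M. P \<mu> x y) * v $ y)"
    by (subst sum.swap) (simp add: sum_distrib_right)
  also have "\<dots> = (\<Sum>y<fst G. if x = y then v $ y else 0)"
    using assms by (intro sum.cong) (auto simp: resolution)
  also have "\<dots> = v $ x" using assms by simp
  finally show ?thesis .
qed

lemma scalar_prod_resolution: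
  assumes "v \<in> carrier_vec (fst G)" "w \<in> carrier_vec (fst G)"
  shows "v \<bullet> w = (\<Sum>\<mu>\<in>M. (Pmat \<mu> *\<^sub>v v) \<bullet> w)"
proof -
  have "v \<bullet> w = (\<Sum>x<fst G. (\<Sum>\<mu>\<in>M. (Pmat \<mu> *\<^sub>v v) $ x) * w $ x)"
    unfolding scalar_prod_def using assms
    by (intro sum.cong) (auto simp: sum_Pmat_mult_vec simp del: index_mult_mat_vec)
  also have "\<dots> = (\<Sum>\<mu>\<in>M. \<Sum>x<fst G. (Pmat \<mu> *\<^sub>v v) $ x * w $ x)"
    by (subst sum.swap) (simp add: sum_distrib_right)
  also have "\<dots> = (\<Sum>\<mu>\<in>M. (Pmat \<mu> *\<^sub>v v) \<bullet> w)"
    using assms(2) by (simp only: scalar_prod_def atLeast0LessThan carrier_vecD)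
  finally show ?thesis .
qed

lemma eig_proj_eq:
  assumes "\<mu> \<in> M"
  shows "eig_proj G \<mu> = Pmat \<mu>"
proof (rule eig_proj_eqI)
  fix v w :: "real vec" assume v: "v \<in> carrier_vec (fst G)" and w: "w \<in> eigenspace G \<mu>"
  have wc: "w \<in> carrier_vec (fst G)" using w by (simp add: eigenspace_def)
  have Pv: "Pmat \<nu> *\<^sub>v v \<in> carrier_vec (fst G)" for \<nu>
    by (rule mult_mat_vec_carrier[OF mat_carrier v])
  have "v \<bullet> w = (Pmat \<mu> *\<^sub>v v) \<bullet> w + (\<Sum>\<nu>\<in>M - {\<mu>}. (Pmat \<nu> *\<^sub>v v) \<bullet> w)"
    using scalar_prod_resolution[OF v wc] sum.remove[OF fin assms] by simp
  also have "(\<Sum>\<nu>\<in>M - {\<mu>}. (Pmat \<nu> *\<^sub>v v) \<bullet> w) = 0"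
    using eigenspaces_orthogonal[OF graph Pmat_in_eigenspace[OF _ v] w] by (intro sum.neutral) auto
  finally show "(v - Pmat \<mu> *\<^sub>v v) \<bullet> w = 0"
    by (simp add: minus_scalar_prod_distrib[OF v Pv wc])
qed (simp_all add: assms Pmat_in_eigenspace)

text \<open>An eigenvector for a value outside \<open>M\<close> is orthogonal to all its components,
  hence to itself. Conversely, a nonzero entry gives a nonzero column, which is an
  eigenvector.\<close>

lemma set_Spec:
  assumes "\<And>\<mu>. \<mu> \<in> M \<Longrightarrow> \<exists>x<fst G. \<exists>y<fst G. P \<mu> x y \<noteq> 0"
  shows "set_mset (Spec G) = M"
proof -
  have "char_poly (adj_mat G) \<noteq> 0"
    using degree_monic_char_poly[OF adj_mat_carrier[of G]] by auto
  then have "set_mset (Spec G) = {\<mu>. eigenvalue (adj_mat G) \<mu>}"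
    by (simp add: Spec_def eigenvalue_root_char_poly[OF adj_mat_carrier])
  also have "\<dots> = M"
  proof (intro equalityI subsetI CollectI; (elim CollectE)?)
    fix \<mu> assume "eigenvalue (adj_mat G) \<mu>"
    then obtain v where v: "v \<in> carrier_vec (fst G)" "v \<noteq> 0\<^sub>v (fst G)" "v \<in> eigenspace G \<mu>"
      by (auto simp: eigenvalue_def eigenvector_def eigenspace_def adj_mat_def)
    show "\<mu> \<in> M"
    proof (rule ccontr)
      assume "\<mu> \<notin> M"
      then have "v \<bullet> v = 0"
        using eigenspaces_orthogonal[OF graph Pmat_in_eigenspace[OF _ v(1)] v(3)]
        by (subst scalar_prod_resolution[OF v(1) v(1)]) (auto intro!: sum.neutral)
      then show False
        using real_scalar_prod_self_eq_0D v by blast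
    qed
  next
    fix \<mu> assume \<mu>: "\<mu> \<in> M"
    then obtain x y where xy: "x < fst G" "y < fst G" "P \<mu> x y \<noteq> 0"
      using assms by blast
    let ?v = "Pmat \<mu> *\<^sub>v unit_vec (fst G) y"
    have "?v $ x = P \<mu> x y" using xy by simp
    then have "?v \<noteq> 0\<^sub>v (fst G)" using xy by (metis index_zero_vec(1))
    moreover have "?v \<in> eigenspace G \<mu>" using \<mu> by (intro Pmat_in_eigenspace) auto
    ultimately show "eigenvalue (adj_mat G) \<mu>"
      unfolding eigenvalue_def eigenvector_def eigenspace_def
      by (intro exI[of _ ?v]) (simp add: adj_mat_def)
  qed
  finally show ?thesis .
qed

lemma Pstar_eq:
  assumes "\<And>\<mu>. \<mu> \<in> M \<Longrightarrow> \<exists>x<fst G. \<exists>y<fst G. P \<mu> x y \<noteq> 0" "x < fst G" "y < fst G"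
  shows "Pstar G x y = map (\<lambda>\<mu>. P \<mu> x y) (sorted_list_of_set M)"
proof -
  have "set_mset (Spec G) = M" by (rule set_Spec) (rule assms(1))
  then show ?thesis
    using assms(2,3) fin by (simp add: Pstar_def distinct_eigs_def eig_proj_eq)
qed

end

section \<open>Joined pairs of cubic graphs\<close>

text \<open>The factor 5 stands for \<open>-1\<close>: this is \<open>y - x\<close> modulo 6 without truncated subtraction.\<close>

definition offset :: "nat \<Rightarrow> nat \<Rightarrow> nat" where
  "offset x y = (y + 5 * x) mod 6"

text \<open>On residues modulo 6 this is the triangular prism (the complement of a 6-cycle) if \<open>b\<close> holds, and
  \<open>K\<^bsub>3,3\<^esub>\<close> (the complement of two triangles) otherwise.\<close>

definition unit_adj :: "bool \<Rightarrow> nat \<Rightarrow> nat \<Rightarrow> bool" where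
  "unit_adj b x y \<longleftrightarrow> offset x y \<in> (if b then {2, 3, 4} else {1, 3, 5})"

text \<open>The unit of a vertex \<open>x\<close> is \<open>x div 6\<close>. Units 0 and 1 are joined completely, and so are units 2 and 3.\<close>

definition unit_graph :: "(nat \<Rightarrow> bool) \<Rightarrow> graph" where
  "unit_graph t = (24, \<lambda>x y. x div 12 = y div 12 \<and>
     (x div 6 = y div 6 \<longrightarrow> unit_adj (t (x div 6)) x y))"

lemma fst_unit_graph [simp]: "fst (unit_graph t) = 24"
  by (simp add: unit_graph_def)

lemma verts_unit_graph: "verts (unit_graph t) = {..<24}"
  by (auto simp: verts_def)

lemma offset_mod [simp]: "offset (x mod 6) y = offset x y" "offset x (y mod 6) = offset x y"
  unfolding offset_def by (intro mod_add_cong mod_mult_cong; simp)+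

lemma offset_shift [simp]: "offset (6 * w + x) y = offset x y" "offset x (6 * w + y) = offset x y"
  by (metis offset_mod mod_mult_self4)+

lemma unit_adj_mod [simp]: "unit_adj b (x mod 6) y = unit_adj b x y" "unit_adj b x (y mod 6) = unit_adj b x y"
  by (simp_all add: unit_adj_def)

lemma unit_adj_shift [simp]: "unit_adj b (6 * w + x) y = unit_adj b x y" "unit_adj b x (6 * w + y) = unit_adj b x y"
  by (simp_all add: unit_adj_def)

lemma div_12: "x div 12 = x div 6 div 2" for x :: nat
  by (simp add: div_mult2_eq)

lemma less_6_cases: "(i::nat) < 6 \<Longrightarrow> i = 0 \<or> i = 1 \<or> i = 2 \<or> i = 3 \<or> i = 4 \<or> i = 5"
  by linarith

lemma less_4_cases: "(i::nat) < 4 \<Longrightarrow> i = 0 \<or> i = 1 \<or> i = 2 \<or> i = 3"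
  by linarith

lemma sum_lessThan_4: "(\<Sum>w<4::nat. f w) = f 0 + f 1 + f 2 + f 3"
  for f :: "nat \<Rightarrow> 'a :: comm_monoid_add"
  by (simp add: lessThan_nat_numeral lessThan_Suc ac_simps)

lemma replicate_mset_plus: "replicate_mset m x + replicate_mset n x = replicate_mset (m + n) x"
  by (rule multiset_eqI) simp

lemma unit_adj_commute: "unit_adj b x y = unit_adj b y x"
proof -
  have "unit_adj b (x mod 6) (y mod 6) = unit_adj b (y mod 6) (x mod 6)"
    using less_6_cases[of "x mod 6", simplified] less_6_cases[of "y mod 6", simplified]
    by (elim disjE) (simp_all add: unit_adj_def offset_def)
  then show ?thesis by simp
qed

lemma not_unit_adj_self: "\<not> unit_adj b x x"
  by (simp add: unit_adj_def offset_def)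

lemma is_graph_unit_graph: "is_graph (unit_graph t)"
  by (auto simp: is_graph_def unit_graph_def unit_adj_commute not_unit_adj_self)

section \<open>The equitable partition after individualization\<close>

text \<open>The labels are relative to \<open>u\<close>, so that labelings for different units, in
  different graphs, can be compared.\<close>

definition unit_label :: "nat \<Rightarrow> nat \<Rightarrow> nat" where
  "unit_label u y = (if y div 6 = u then y mod 6 else if y div 12 = u div 2 then 6 else 7)"

abbreviation unit_mset :: "nat multiset" where
  "unit_mset \<equiv> mset_set {..<6}"

text \<open>Once a vertex of unit \<open>u\<close> is individualized, the partition into the single vertices of \<open>u\<close>, the unit
  joined to \<open>u\<close>, and the remaining 12 vertices is equitable, with parameters that see the type of \<open>u\<close> only.\<close>

definition label_nbrs :: "bool \<Rightarrow> nat \<Rightarrow> nat multiset" where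
  "label_nbrs b l =
     (if l < 6 then filter_mset (unit_adj b l) unit_mset + replicate_mset 6 6
      else if l = 6 then unit_mset + replicate_mset 3 6
      else replicate_mset 9 7)"

lemma mset_set_lessThan_24:
  "mset_set {..<24::nat} = (\<Sum>w<4. image_mset ((+) (6 * w)) unit_mset)"
proof -
  have *: "image_mset ((+) (6 * w)) unit_mset = mset_set {6 * w..<6 * Suc w}" for w
    by (subst image_mset_mset_set) (auto simp: image_add_atLeastLessThan lessThan_atLeast0 ac_simps)
  have "(\<Sum>w<n. mset_set {6 * w..<6 * Suc w}) = mset_set {..<6 * n}" for n :: nat
  proof (induction n)
    case (Suc n)
    have eq: "{..<6 * Suc n} = {..<6 * n} \<union> {6 * n..<6 * Suc n}" by auto
    show ?case
      unfolding sum.lessThan_Suc Suc.IH eq by (rule mset_set_Union[symmetric]) auto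
  qed simp
  from this[of 4] show ?thesis unfolding * by simp
qed

lemma filter_mset_sum: "finite A \<Longrightarrow> filter_mset P (\<Sum>x\<in>A. f x) = (\<Sum>x\<in>A. filter_mset P (f x))"
  by (induction A rule: finite_induct) auto

lemma image_mset_sum: "finite A \<Longrightarrow> image_mset g (\<Sum>x\<in>A. f x) = (\<Sum>x\<in>A. image_mset g (f x))"
  by (induction A rule: finite_induct) auto

lemma size_unit_nbrs: "size (filter_mset (unit_adj b y) unit_mset) = 3"
proof -
  have "unit_mset = mset [0, 1, 2, 3, 4, 5]"
    by (simp add: lessThan_nat_numeral lessThan_Suc)
  then have "size (filter_mset (unit_adj b (y mod 6)) unit_mset) = 3"
    using less_6_cases[of "y mod 6", simplified]
    by (cases b; elim disjE) (simp_all add: unit_adj_def offset_def)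
  then show ?thesis by simp
qed

text \<open>Neighbors are counted unit by unit. Outside \<open>u\<close> all vertices of a unit
  share one label, so only 3-regularity matters there; the 9 in \<open>label_nbrs\<close> is 3
  neighbors in the own unit plus 6 in the joined one.\<close>

lemma labels_nbrs:
  assumes "u < 4" "y < 24"
  shows "image_mset (unit_label u) (mset_set (nbrs (unit_graph t) y)) =
    label_nbrs (t (y div 6)) (unit_label u y)"
proof -
  define v b where "v = y div 6" and "b = t v"
  let ?N = "\<lambda>w. image_mset (\<lambda>j. if w = u then j else if w div 2 = u div 2 then 6 else 7)
    (filter_mset (\<lambda>j. v div 2 = w div 2 \<and> (v = w \<longrightarrow> unit_adj b y j)) unit_mset)"
  have "nbrs (unit_graph t) y = {z \<in> {..<24}. snd (unit_graph t) y z}"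
    by (simp add: nbrs_def verts_unit_graph)
  then have "image_mset (unit_label u) (mset_set (nbrs (unit_graph t) y)) =
    (\<Sum>w<4. image_mset (unit_label u) (filter_mset (snd (unit_graph t) y) (image_mset ((+) (6 * w)) unit_mset)))"
    by (simp only: filter_mset_mset_set[symmetric] finite_lessThan mset_set_lessThan_24 filter_mset_sum image_mset_sum)
  also have "\<dots> = (\<Sum>w<4. ?N w)"
  proof (rule sum.cong[OF refl])
    fix w :: nat
    show "image_mset (unit_label u) (filter_mset (snd (unit_graph t) y) (image_mset ((+) (6 * w)) unit_mset)) = ?N w"
      unfolding filter_mset_image_mset multiset.map_comp
      by (intro multiset.map_cong filter_mset_cong refl)
        (auto simp: unit_label_def unit_graph_def div_12 v_def b_def)
  qed
  also have "\<dots> = ?N 0 + ?N 1 + ?N 2 + ?N 3"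
    by (rule sum_lessThan_4)
  also have "\<dots> = label_nbrs b (unit_label u y)"
  proof -
    have v: "v < 4" using assms by (simp add: v_def)
    have l: "unit_label u y = (if v = u then y mod 6 else if v div 2 = u div 2 then 6 else 7)"
      by (simp add: unit_label_def v_def div_12)
    show ?thesis
      unfolding l using less_4_cases[OF v] less_4_cases[OF assms(1)]
      by (elim disjE) (simp_all add: label_nbrs_def image_mset_const_eq size_unit_nbrs[simplified] replicate_mset_plus)
  qed
  finally show ?thesis by (simp add: b_def v_def)
qed

lemma labels_verts:
  assumes "u < 4"
  shows "image_mset (unit_label u) (mset_set (verts (unit_graph t))) =
    unit_mset + replicate_mset 6 6 + replicate_mset 12 7"
proof -
  have "image_mset (unit_label u) (mset_set (verts (unit_graph t))) =
    (\<Sum>w<4. image_mset (\<lambda>j. if w = u then j else if w div 2 = u div 2 then 6 else 7) unit_mset)"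
    unfolding verts_unit_graph mset_set_lessThan_24 image_mset_sum[OF finite_lessThan] multiset.map_comp
    by (intro sum.cong refl image_mset_cong) (auto simp: unit_label_def div_12)
  also have "\<dots> = unit_mset + replicate_mset 6 6 + replicate_mset 12 7"
    using less_4_cases[OF assms]
    by (elim disjE) (simp_all add: sum_lessThan_4 image_mset_const_eq replicate_mset_plus)
  finally show ?thesis .
qed

text \<open>The labelings relative to the units of \<open>x\<close> and \<open>x'\<close> are
  jointly equitable: the type of a unit matters only for labels below 6, that is, inside these two
  units, whose types agree.\<close>

lemma WL1_indiv_unit_graph:
  assumes "x < 24" "x' < 24" "x mod 6 = x' mod 6" "t (x div 6) = t' (x' div 6)"
  shows "WL1 (unit_graph t) (indiv x) = WL1 (unit_graph t') (indiv x')"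
proof (rule WL1_eq_if_equitable[where p = "unit_label (x div 6)" and q = "unit_label (x' div 6)"])
  have u: "x div 6 < 4" "x' div 6 < 4" using assms by auto
  show "image_mset (unit_label (x div 6)) (mset_set (verts (unit_graph t))) =
      image_mset (unit_label (x' div 6)) (mset_set (verts (unit_graph t')))"
    using u by (simp add: labels_verts)
  fix y z
  assume "y \<in> verts (unit_graph t)" "z \<in> verts (unit_graph t')"
    and l: "unit_label (x div 6) y = unit_label (x' div 6) z"
  then have yz: "y < 24" "z < 24" by (auto simp: verts_unit_graph)
  have less: "unit_label u w < 6 \<longleftrightarrow> w div 6 = u" for u w
    by (auto simp: unit_label_def)
  \<comment> \<open>The individualized vertex is the only one with its label, so labels determine
    the initial colors.\<close>
  have indiv: "indiv a w = (if unit_label (a div 6) w = a mod 6 then 1 else 0)" for a w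
  proof -
    have "w = a \<longleftrightarrow> w div 6 = a div 6 \<and> w mod 6 = a mod 6" by (metis div_mult_mod_eq)
    then show ?thesis by (auto simp: indiv_def unit_label_def)
  qed
  show "indiv x y = indiv x' z"
    by (simp add: indiv l assms(3))
  have "label_nbrs (t (y div 6)) (unit_label (x div 6) y) = label_nbrs (t' (z div 6)) (unit_label (x' div 6) z)"
  proof (cases "unit_label (x div 6) y < 6")
    case True
    then have "y div 6 = x div 6" "z div 6 = x' div 6" using less l by metis+
    then show ?thesis using l assms(4) by simp
  next
    case False
    then show ?thesis by (simp add: l label_nbrs_def)
  qed
  then show "image_mset (unit_label (x div 6)) (mset_set (nbrs (unit_graph t) y)) =
      image_mset (unit_label (x' div 6)) (mset_set (nbrs (unit_graph t') z))"
    by (simp add: labels_nbrs u yz)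
qed simp

section \<open>Rearranging the units\<close>

text \<open>Keeping residues preserves the structure inside units, but joined pairs may be torn
  apart: this is a matching of vertices, in general not an isomorphism.\<close>

definition unit_perm :: "(nat \<Rightarrow> nat) \<Rightarrow> nat \<Rightarrow> nat" where
  "unit_perm \<pi> x = 6 * \<pi> (x div 6) + x mod 6"

lemma unit_perm_div_mod [simp]: "unit_perm \<pi> x div 6 = \<pi> (x div 6)" "unit_perm \<pi> x mod 6 = x mod 6"
  by (simp_all add: unit_perm_def)

locale unit_involution =
  fixes \<pi> :: "nat \<Rightarrow> nat"
  assumes involution [simp]: "\<pi> (\<pi> u) = u" and less_4: "u < 4 \<Longrightarrow> \<pi> u < 4"
begin

lemma unit_perm_less: "x < 24 \<Longrightarrow> unit_perm \<pi> x < 24"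
proof -
  assume "x < 24"
  then have "\<pi> (x div 6) < 4" by (intro less_4) simp
  moreover have "x mod 6 < 6" by simp
  ultimately show ?thesis unfolding unit_perm_def by linarith
qed

lemma unit_perm_unit_perm [simp]: "unit_perm \<pi> (unit_perm \<pi> x) = x"
  by (simp add: unit_perm_def)

lemma image_mset_unit_perm:
  "image_mset f (mset_set {..<24}) = image_mset (\<lambda>x. f (unit_perm \<pi> x)) (mset_set {..<24})"
proof -
  have "bij_betw (unit_perm \<pi>) {..<24} {..<24}"
    by (rule bij_betw_byWitness[where f' = "unit_perm \<pi>"]) (auto simp: unit_perm_less)
  then have "mset_set {..<24} = image_mset (unit_perm \<pi>) (mset_set {..<24})"
    by (simp add: bij_betw_def image_mset_mset_set)
  from arg_cong[OF this, of "image_mset f"] show ?thesis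
    by (simp add: multiset.map_comp comp_def)
qed

text \<open>The vertex \<open>x\<close> is matched with \<open>unit_perm \<pi> x\<close>, which has
  the same residue and lies in a unit of the same type.\<close>

lemma WL32_unit_graph: "WL32 (unit_graph (\<lambda>u. t (\<pi> u))) = WL32 (unit_graph t)"
proof -
  have "WL32 (unit_graph t) =
    image_mset (\<lambda>x. WL1 (unit_graph t) (indiv (unit_perm \<pi> x))) (mset_set {..<24})"
    unfolding WL32_def verts_unit_graph by (rule image_mset_unit_perm)
  also have "\<dots> = WL32 (unit_graph (\<lambda>u. t (\<pi> u)))"
    unfolding WL32_def verts_unit_graph
    by (intro image_mset_cong WL1_indiv_unit_graph) (simp_all add: unit_perm_less)
  finally show ?thesis ..
qed

end

section \<open>Explicit spectral projections\<close>

lemma sum_lessThan_24: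
  "(\<Sum>k<24::nat. f k) = (\<Sum>w<4. \<Sum>j<6. f (6 * w + j))" for f :: "nat \<Rightarrow> real"
proof -
  have "(\<Sum>k<24. f k) = sum_mset (image_mset f (mset_set {..<24}))"
    by (simp add: sum_unfold_sum_mset)
  also have "\<dots> = (\<Sum>w<4. \<Sum>j<6. f (6 * w + j))"
    unfolding mset_set_lessThan_24 sum_lessThan_4
    by (simp add: sum_unfold_sum_mset multiset.map_comp comp_def)
  finally show ?thesis .
qed

lemma sum_lessThan_6: "(\<Sum>j<6::nat. f j) = f 0 + f 1 + f 2 + f 3 + f 4 + f 5" for f :: "nat \<Rightarrow> real"
  by (simp add: lessThan_nat_numeral lessThan_Suc ac_simps)

lemma sum_if_unit:
  fixes f :: "nat \<Rightarrow> real"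
  assumes "w < 4"
  shows "(\<Sum>k<24::nat. if k div 6 = w then f k else 0) = (\<Sum>j<6. f (6 * w + j))"
  using less_4_cases[OF assms] by (auto simp: sum_lessThan_24 sum_lessThan_4)

definition adj :: "(nat \<Rightarrow> bool) \<Rightarrow> nat \<Rightarrow> nat \<Rightarrow> real" where
  "adj t x y = (if snd (unit_graph t) x y then 1 else 0)"

text \<open>The quotient matrix of the partition into units. It is the same for all types, since
  every unit is 3-regular.\<close>

definition unit_sum :: "nat \<Rightarrow> nat \<Rightarrow> real" where
  "unit_sum u v = (if u = v then 3 else if u div 2 = v div 2 then 6 else 0)"

lemma adj_eq:
  "adj t x y =
    (if x div 6 = y div 6 then of_bool (unit_adj (t (x div 6)) x y)
     else unit_sum (x div 6) (y div 6) / 6)"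
  by (auto simp: adj_def unit_graph_def unit_sum_def div_12)

lemma adj_unit:
  "j < 6 \<Longrightarrow> adj t x (6 * w + j) =
    (if x div 6 = w then of_bool (unit_adj (t w) x j) else unit_sum (x div 6) w / 6)"
  by (simp add: adj_eq)

lemma adj_commute: "adj t x y = adj t y x"
  by (auto simp: adj_def unit_graph_def unit_adj_commute)

lemma sum_offset: "(\<Sum>j<6. g (offset x j)) = (\<Sum>j<6. g j)" for g :: "nat \<Rightarrow> real"
proof -
  have "(\<Sum>j<6. g (offset (x mod 6) j)) = (\<Sum>j<6. g j)"
    using less_6_cases[of "x mod 6", simplified]
    by (elim disjE) (simp_all del: offset_mod add: sum_lessThan_6 offset_def)
  then show ?thesis by simp
qed

lemma offset_offset: "offset (offset z x) (offset z y) = offset x y"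
proof -
  have "offset (offset z x) (offset z y) = ((y + 5 * z) + 5 * (x + 5 * z)) mod 6"
    unfolding offset_def by (intro mod_add_cong mod_mult_cong) simp_all
  also have "(y + 5 * z) + 5 * (x + 5 * z) = (y + 5 * x) + 6 * (5 * z)"
    by simp
  finally show ?thesis by (simp only: offset_def mod_mult_self2)
qed

lemma offset_less: "offset x y < 6"
  by (simp add: offset_def)

lemma sum_unit_adj: "(\<Sum>j<6. of_bool (unit_adj b x j)) = (3 :: real)"
  using sum_offset[of "\<lambda>d. of_bool (d \<in> (if b then {2, 3, 4} else {1, 3, 5}))" x]
  by (cases b) (simp_all add: unit_adj_def sum_lessThan_6)

lemma sum_adj: "(\<Sum>j<6. adj t x (6 * w + j)) = unit_sum (x div 6) w"
proof (cases "x div 6 = w")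
  case True
  then show ?thesis by (simp add: adj_unit sum_unit_adj) (simp add: unit_sum_def)
qed (simp add: adj_unit)

text \<open>Spectral projections of the two cubic graphs on the orthogonal complement of the constant vector, as
  functions of the offset: \<open>K\<^bsub>3,3\<^esub>\<close> has the eigenvalues \<open>0, -3\<close> there, and the prism \<open>0, -2, 1\<close>.\<close>

definition unit_proj :: "bool \<Rightarrow> real \<Rightarrow> nat \<Rightarrow> real" where
  "unit_proj b \<mu> d =
     (if \<mu> = 0 then (if b then [2, -1, -1, 2, -1, -1] else [4, 0, -2, 0, -2, 0]) ! d
      else if b \<and> \<mu> = -2 then [2, 1, -1, -2, -1, 1] ! d
      else if \<mu> = (if b then 1 else -3) then (-1) ^ d
      else 0) / 6"

text \<open>Spectral projections on the vectors that are constant on units: a pair of joined units contributes the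
  quotient matrix with rows \<open>(3, 6)\<close> and \<open>(6, 3)\<close>, whose eigenvalues are 9 and \<open>-3\<close>.\<close>

definition const_proj :: "real \<Rightarrow> nat \<Rightarrow> nat \<Rightarrow> real" where
  "const_proj \<mu> u v =
     (if u div 2 = v div 2
      then (if \<mu> = 9 then 1 else if \<mu> = -3 then (if u = v then 1 else -1) else 0) / 12
      else 0)"

text \<open>The adjacency matrix preserves the vectors with zero sum on every unit as well as those
  constant on units, so the projections on the two complements add up. The eigenvalue -3 can occur
  in both.\<close>

definition proj :: "(nat \<Rightarrow> bool) \<Rightarrow> real \<Rightarrow> nat \<Rightarrow> nat \<Rightarrow> real" where
  "proj t \<mu> x y =
     (if x div 6 = y div 6 then unit_proj (t (x div 6)) \<mu> (offset x y) else 0) +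
     const_proj \<mu> (x div 6) (y div 6)"

abbreviation eigs :: "real set" where
  "eigs \<equiv> {-3, -2, 0, 1, 9}"

lemma unit_proj_eigen:
  assumes "\<mu> \<in> eigs"
  shows "(\<Sum>j<6. of_bool (unit_adj b x j) * unit_proj b \<mu> (offset j y)) = \<mu> * unit_proj b \<mu> (offset x y)"
proof -
  let ?S = "if b then {2, 3, 4} else {1, 3, 5 :: nat}"
  define e where "e = offset x y"
  \<comment> \<open>Both units are circulant: substituting \<open>d = offset x j\<close> leaves a
    finite check over the residue \<open>e\<close>.\<close>
  have "(\<Sum>j<6. of_bool (unit_adj b x j) * unit_proj b \<mu> (offset j y)) =
      (\<Sum>j<6. of_bool (offset x j \<in> ?S) * unit_proj b \<mu> (offset (offset x j) e))"
    by (simp add: unit_adj_def e_def offset_offset)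
  also have "\<dots> = (\<Sum>d<6. of_bool (d \<in> ?S) * unit_proj b \<mu> (offset d e))"
    by (rule sum_offset)
  also have "\<dots> = \<mu> * unit_proj b \<mu> e"
    using less_6_cases[OF offset_less[of x y], folded e_def] assms
    unfolding insert_iff empty_iff
    by (cases b; elim disjE) (simp_all add: sum_lessThan_6 offset_def unit_proj_def)
  finally show ?thesis by (simp only: e_def)
qed

text \<open>Vanishing column sums: the zero-sum part contributes nothing across a join, where the
  adjacency entries are constant.\<close>

lemma sum_unit_proj: "(\<Sum>j<6. unit_proj b \<mu> (offset j y)) = 0"
proof -
  have "(\<Sum>j<6. unit_proj b \<mu> (offset j (y mod 6))) = 0"
    using less_6_cases[of "y mod 6", simplified]
    by (cases b; elim disjE)
      (simp_all del: offset_mod add: sum_lessThan_6 offset_def unit_proj_def)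
  then show ?thesis by simp
qed

lemma unit_sum_const_proj:
  assumes "\<mu> \<in> eigs" "u < 4" "v < 4"
  shows "(\<Sum>w<4. unit_sum u w * const_proj \<mu> w v) = \<mu> * const_proj \<mu> u v"
  using less_4_cases[OF assms(2)] less_4_cases[OF assms(3)] assms(1)
  by (elim disjE) (auto simp: sum_lessThan_4 unit_sum_def const_proj_def)

text \<open>The summands of \<open>proj\<close> are treated separately: the first lives on the unit
  of \<open>y\<close>, the second sees only the row sums \<open>unit_sum\<close>.\<close>

lemma proj_eigen:
  assumes "\<mu> \<in> eigs" "x < 24" "y < 24"
  shows "(\<Sum>k<24. adj t x k * proj t \<mu> k y) = \<mu> * proj t \<mu> x y"
proof -
  define u v where "u = x div 6" and "v = y div 6"
  have uv: "u < 4" "v < 4" using assms by (auto simp: u_def v_def)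
  have "(\<Sum>k<24. adj t x k * proj t \<mu> k y) =
    (\<Sum>k<24. if k div 6 = v then adj t x k * unit_proj (t v) \<mu> (offset k y) else 0) +
    (\<Sum>k<24. adj t x k * const_proj \<mu> (k div 6) v)"
    unfolding sum.distrib[symmetric]
    by (intro sum.cong) (auto simp: proj_def v_def distrib_left)
  also have "(\<Sum>k<24. if k div 6 = v then adj t x k * unit_proj (t v) \<mu> (offset k y) else 0) =
      (\<Sum>j<6. adj t x (6 * v + j) * unit_proj (t v) \<mu> (offset j y))"
    using uv by (simp add: sum_if_unit)
  also have "\<dots> = (if u = v then \<mu> * unit_proj (t v) \<mu> (offset x y) else 0)"
  proof (cases "u = v")
    case True
    then show ?thesis using unit_proj_eigen[OF assms(1)] by (simp add: adj_unit u_def)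
  next
    case False
    then show ?thesis
      using sum_unit_proj[of "t v" \<mu> y] by (simp add: adj_unit u_def flip: sum_distrib_left sum_divide_distrib)
  qed
  also have "(\<Sum>k<24. adj t x k * const_proj \<mu> (k div 6) v) =
      (\<Sum>w<4. (\<Sum>j<6. adj t x (6 * w + j)) * const_proj \<mu> w v)"
    by (simp add: sum_lessThan_24 sum_distrib_right)
  also have "\<dots> = \<mu> * const_proj \<mu> u v"
    using unit_sum_const_proj[OF assms(1) uv] by (simp add: sum_adj u_def)
  finally show ?thesis by (simp add: proj_def u_def v_def distrib_left)
qed

text \<open>Within a unit the zero-sum projections add up to the identity minus the averaging matrix
  with entries 1/6; the projections \<open>const_proj\<close> restore this averaging.\<close>

lemma sum_proj:
  "(\<Sum>\<mu>\<in>eigs. proj t \<mu> x y) = (if x = y then 1 else 0)"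
proof -
  have xy: "x = y \<longleftrightarrow> x div 6 = y div 6 \<and> x mod 6 = y mod 6" by (metis div_mult_mod_eq)
  have "offset x y = 0 \<longleftrightarrow> x mod 6 = y mod 6"
  proof -
    have "offset (x mod 6) (y mod 6) = 0 \<longleftrightarrow> x mod 6 = y mod 6"
      using less_6_cases[of "x mod 6", simplified] less_6_cases[of "y mod 6", simplified]
      by (elim disjE) (simp_all del: offset_mod add: offset_def)
    then show ?thesis by simp
  qed
  moreover have "(\<Sum>\<mu>\<in>eigs. unit_proj b \<mu> d) = (if d = 0 then 1 else 0) - 1 / 6" if "d < 6" for b d
    using less_6_cases[OF that] by (cases b; elim disjE) (simp_all add: unit_proj_def)
  ultimately have "(\<Sum>\<mu>\<in>eigs. unit_proj b \<mu> (offset x y)) = (if x mod 6 = y mod 6 then 1 else 0) - 1 / 6" for b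
    by (simp only: offset_less)
  moreover have "(\<Sum>\<mu>\<in>eigs. const_proj \<mu> u v) = (if u = v then 1 / 6 else 0)" for u v
    by (simp add: const_proj_def)
  ultimately show ?thesis
    unfolding xy proj_def sum.distrib by simp
qed

lemma spectral_resolution_unit_graph: "spectral_resolution (unit_graph t) eigs (proj t)"
  by unfold_locales (simp_all only: is_graph_unit_graph fst_unit_graph proj_eigen[unfolded adj_def] sum_proj finite_insert finite.emptyI)

text \<open>The prism \<open>w\<close> ensures that -2 and 1 are eigenvalues; all five projections
  have a nonzero diagonal entry at \<open>6 * w\<close>.\<close>

lemma Pstar_unit_graph:
  assumes "w < 4" "t w" "x < 24" "y < 24"
  shows "Pstar (unit_graph t) x y = map (\<lambda>\<mu>. proj t \<mu> x y) [-3, -2, 0, 1, 9]"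
proof -
  interpret spectral_resolution "unit_graph t" eigs "proj t"
    by (rule spectral_resolution_unit_graph)
  have "proj t \<mu> (6 * w) (6 * w) \<noteq> 0" if "\<mu> \<in> eigs" for \<mu>
    using that \<open>t w\<close> by (auto simp: proj_def unit_proj_def const_proj_def offset_def)
  then have "\<exists>x<fst (unit_graph t). \<exists>y<fst (unit_graph t). proj t \<mu> x y \<noteq> 0" if "\<mu> \<in> eigs" for \<mu>
    using that assms(1) by (intro exI[of _ "6 * w"] conjI) auto
  then have "Pstar (unit_graph t) x y = map (\<lambda>\<mu>. proj t \<mu> x y) (sorted_list_of_set eigs)"
    by (rule Pstar_eq) (use assms in auto)
  also have "sorted_list_of_set eigs = [-3, -2, 0, 1, 9]"
    by simp
  finally show ?thesis .
qed

section \<open>Cospectrality by switching\<close>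

lemma adj_mat_unit_graph: "adj_mat (unit_graph t) = mat 24 24 (\<lambda>(x, y). adj t x y)"
  by (auto simp: adj_mat_def adj_def)

context unit_involution
begin

text \<open>The orthogonal involution that permutes the units by \<open>\<pi>\<close> on vectors with zero sum on every unit, and
  fixes the vectors that are constant on units.\<close>

definition switch :: "nat \<Rightarrow> nat \<Rightarrow> real" where
  "switch x y = of_bool (unit_perm \<pi> x = y) + (of_bool (x div 6 = y div 6) - of_bool (\<pi> (x div 6) = y div 6)) / 6"

lemma switch_commute: "switch x y = switch y x"
proof -
  have "unit_perm \<pi> x = y \<longleftrightarrow> unit_perm \<pi> y = x" "\<pi> (x div 6) = y div 6 \<longleftrightarrow> \<pi> (y div 6) = x div 6"
    by (metis unit_perm_unit_perm) (metis involution)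
  then show ?thesis by (auto simp: switch_def)
qed

lemma sum_switch:
  assumes "x < 24"
  shows "(\<Sum>k<24. switch x k * f k) = f (unit_perm \<pi> x) +
    ((\<Sum>j<6. f (6 * (x div 6) + j)) - (\<Sum>j<6. f (6 * \<pi> (x div 6) + j))) / 6"
proof -
  have u: "x div 6 < 4" using assms by auto
  have "(\<Sum>k<24. switch x k * f k) =
    (\<Sum>k<24. (if unit_perm \<pi> x = k then f k else 0) +
      ((if k div 6 = x div 6 then f k else 0) - (if k div 6 = \<pi> (x div 6) then f k else 0)) / 6)"
    by (intro sum.cong) (auto simp: switch_def)
  also have "\<dots> = f (unit_perm \<pi> x) +
    ((\<Sum>j<6. f (6 * (x div 6) + j)) - (\<Sum>j<6. f (6 * \<pi> (x div 6) + j))) / 6"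
    using sum_if_unit[OF u, of f] sum_if_unit[OF less_4[OF u], of f] unit_perm_less[OF assms]
    by (simp add: sum.distrib sum_subtractf flip: sum_divide_distrib)
  finally show ?thesis .
qed

lemma sum_switch_unit:
  "(\<Sum>j<6. switch (6 * w + j) y) = of_bool (w = y div 6)"
proof -
  have "(\<Sum>j<6. switch (6 * w + j) y) =
    (\<Sum>j<6. (if y mod 6 = j then of_bool (\<pi> w = y div 6) else 0) +
       (of_bool (w = y div 6) - of_bool (\<pi> w = y div 6)) / 6)"
  proof (rule sum.cong)
    fix j :: nat assume "j \<in> {..<6}"
    then have "unit_perm \<pi> (6 * w + j) = y \<longleftrightarrow> y mod 6 = j \<and> \<pi> w = y div 6"
      by (auto simp: unit_perm_def)
    then show "switch (6 * w + j) y = (if y mod 6 = j then of_bool (\<pi> w = y div 6) else 0) +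
        (of_bool (w = y div 6) - of_bool (\<pi> w = y div 6)) / 6"
      using \<open>j \<in> {..<6}\<close> by (simp add: switch_def)
  qed simp
  also have "\<dots> = of_bool (w = y div 6)"
    by (simp add: sum.distrib)
  finally show ?thesis .
qed

lemma switch_switch:
  assumes "x < 24"
  shows "(\<Sum>k<24. switch x k * switch k y) = of_bool (x = y)"
proof -
  have "switch (unit_perm \<pi> x) y = of_bool (x = y) +
      (of_bool (\<pi> (x div 6) = y div 6) - of_bool (x div 6 = y div 6)) / 6"
    by (simp add: switch_def)
  then show ?thesis
    unfolding sum_switch[OF assms] sum_switch_unit by argo
qed

text \<open>\<open>switch\<close> intertwines the two adjacency matrices: on zero-sum vectors it
  permutes the unit blocks, and on vectors constant on units both matrices act by the same quotient
  matrix.\<close>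

lemma switch_adj:
  assumes "x < 24" "y < 24"
  shows "(\<Sum>k<24. switch x k * adj t k y) = (\<Sum>k<24. adj (\<lambda>u. t (\<pi> u)) x k * switch k y)"
proof -
  let ?t = "\<lambda>u. t (\<pi> u)"
  have "(\<Sum>k<24. switch x k * adj t k y) = adj t (unit_perm \<pi> x) y +
      (unit_sum (y div 6) (x div 6) - unit_sum (y div 6) (\<pi> (x div 6))) / 6"
    by (simp add: sum_switch[OF assms(1)] adj_commute[of t _ y] sum_adj)
  moreover have "(\<Sum>k<24. adj ?t x k * switch k y) = (\<Sum>k<24. switch y k * adj ?t x k)"
    by (simp add: switch_commute[of _ y] mult.commute)
  then have "(\<Sum>k<24. adj ?t x k * switch k y) = adj ?t x (unit_perm \<pi> y) +
      (unit_sum (x div 6) (y div 6) - unit_sum (x div 6) (\<pi> (y div 6))) / 6"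
    by (simp add: sum_switch[OF assms(2)] sum_adj)
  \<comment> \<open>If the units correspond under \<open>\<pi>\<close>, both entries come from the
    same unit type and both sums are 3. Otherwise each entry is \<open>unit_sum / 6\<close> and both
    sides vanish.\<close>
  moreover have "adj t (unit_perm \<pi> x) y - unit_sum (y div 6) (\<pi> (x div 6)) / 6 =
      adj ?t x (unit_perm \<pi> y) - unit_sum (x div 6) (\<pi> (y div 6)) / 6"
  proof -
    have commute: "unit_sum u v = unit_sum v u" for u v by (simp add: unit_sum_def)
    have iff: "\<pi> (x div 6) = y div 6 \<longleftrightarrow> x div 6 = \<pi> (y div 6)" by (metis involution)
    have "unit_adj b (unit_perm \<pi> x) y = unit_adj b x y" "unit_adj b x (unit_perm \<pi> y) = unit_adj b x y" for b
      by (metis unit_adj_mod unit_perm_div_mod(2))+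
    note adj = this
    show ?thesis
    proof (cases "\<pi> (x div 6) = y div 6")
      case True
      then show ?thesis using iff by (simp add: adj_eq adj unit_sum_def)
    next
      case False
      then show ?thesis using iff by (simp add: adj_eq commute[of "y div 6" "\<pi> (x div 6)"])
    qed
  qed
  moreover have "unit_sum (y div 6) (x div 6) = unit_sum (x div 6) (y div 6)"
    by (simp add: unit_sum_def)
  ultimately show ?thesis by argo
qed

text \<open>\<open>set_Spec\<close> gives the eigenvalues without multiplicities; conjugation by the
  self-inverse matrix \<open>switch\<close> gives the whole multiset.\<close>

lemma Spec_unit_graph: "Spec (unit_graph (\<lambda>u. t (\<pi> u))) = Spec (unit_graph t)"
proof -
  let ?A = "adj_mat (unit_graph t)" and ?B = "adj_mat (unit_graph (\<lambda>u. t (\<pi> u)))"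
  let ?U = "mat 24 24 (\<lambda>(x, y). switch x y)"
  have carrier: "?A \<in> carrier_mat 24 24" "?B \<in> carrier_mat 24 24" "?U \<in> carrier_mat 24 24"
    by (simp_all add: adj_mat_unit_graph)
  have UU: "?U * ?U = 1\<^sub>m 24"
    by (rule eq_matI) (auto simp: scalar_prod_def atLeast0LessThan switch_switch)
  have "?U * ?A = ?B * ?U"
    by (rule eq_matI) (auto simp: adj_mat_unit_graph scalar_prod_def atLeast0LessThan switch_adj)
  then have "?U * ?A * ?U = ?B * (?U * ?U)"
    using assoc_mult_mat[OF carrier(2,3,3)] by simp
  then have B: "?B = ?U * ?A * ?U"
    by (simp only: UU right_mult_one_mat[OF carrier(2)])
  have "similar_mat ?B ?A"
    by (rule similar_matI[OF _ UU UU B]) (use carrier in blast)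
  then show ?thesis
    by (simp add: Spec_def char_poly_similar)
qed

end

section \<open>Equality of the weak invariants\<close>

text \<open>For fixed \<open>x\<close>, the label of \<open>y\<close> determines the entry. The
  arguments \<open>0 0\<close> and \<open>0 1\<close> of \<open>const_proj\<close> represent equal
  and joined units.\<close>

lemma proj_label:
  "proj t \<mu> x y =
    (if unit_label (x div 6) y < 6
     then unit_proj (t (x div 6)) \<mu> (offset x (unit_label (x div 6) y)) + const_proj \<mu> 0 0
     else if unit_label (x div 6) y = 6 then const_proj \<mu> 0 1 else 0)"
proof -
  define u v where "u = x div 6" and "v = y div 6"
  have "unit_label u y = (if v = u then y mod 6 else if v div 2 = u div 2 then 6 else 7)"
    by (simp add: unit_label_def v_def div_12)
  moreover have "proj t \<mu> x y = (if u = v then unit_proj (t u) \<mu> (offset x y) else 0) + const_proj \<mu> u v"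
    by (simp add: proj_def u_def v_def)
  ultimately show ?thesis
    unfolding u_def[symmetric] by (auto simp: const_proj_def)
qed

lemma proj_eq_if_same_label:
  assumes "x mod 6 = x' mod 6" "t (x div 6) = t' (x' div 6)"
    and "unit_label (x div 6) y = unit_label (x' div 6) y'"
  shows "proj t \<mu> x y = proj t' \<mu> x' y'"
proof -
  have "offset x l = offset x' l" for l
    by (metis offset_mod(1) assms(1))
  then show ?thesis unfolding proj_label assms(2,3) by simp
qed

lemma Pstar_unit_graph_multiset:
  assumes "w < 4" "t w" "w' < 4" "t' w'" "x < 24" "x' < 24"
    and "x mod 6 = x' mod 6" "t (x div 6) = t' (x' div 6)"
  shows "image_mset (Pstar (unit_graph t) x) (mset_set {..<24}) =
    image_mset (Pstar (unit_graph t') x') (mset_set {..<24})"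
proof (rule image_mset_eq_if_refines)
  have "x div 6 < 4" "x' div 6 < 4" using assms by auto
  then show "image_mset (unit_label (x div 6)) (mset_set {..<24}) =
      image_mset (unit_label (x' div 6)) (mset_set {..<24})"
    using labels_verts by (simp add: verts_unit_graph)
next
  fix y y'
  assume "y \<in># mset_set {..<24}" "y' \<in># mset_set {..<24}"
    and "unit_label (x div 6) y = unit_label (x' div 6) y'"
  then show "Pstar (unit_graph t) x y = Pstar (unit_graph t') x' y'"
    using assms proj_eq_if_same_label[of x x' t t' y y']
    by (simp add: Pstar_unit_graph[of w t] Pstar_unit_graph[of w' t'])
qed

text \<open>Again \<open>x\<close> is matched with \<open>unit_perm \<pi> x\<close>. The argument
  does not extend to \<open>F_strong\<close>: labels 6 and 7 do not tell the type of the unit of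
  \<open>y\<close>, which the diagonal entries at \<open>y\<close> depend on.\<close>

lemma (in unit_involution) F_weak_unit_graph:
  assumes "w < 4" "t w"
  shows "F_weak (unit_graph (\<lambda>u. t (\<pi> u))) = F_weak (unit_graph t)"
proof -
  let ?t = "\<lambda>u. t (\<pi> u)"
  let ?inv = "\<lambda>t x. (Pstar (unit_graph t) x x, image_mset (Pstar (unit_graph t) x) (mset_set {..<24}))"
  have w': "\<pi> w < 4" "?t (\<pi> w)" using assms less_4 by auto
  have "image_mset (?inv ?t) (mset_set {..<24}) = image_mset (\<lambda>x. ?inv t (unit_perm \<pi> x)) (mset_set {..<24})"
  proof (rule image_mset_cong)
    fix x :: nat assume "x \<in># mset_set {..<24}"
    then have x: "x < 24" "unit_perm \<pi> x < 24" by (auto simp: unit_perm_less)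
    have "proj ?t \<mu> x x = proj t \<mu> (unit_perm \<pi> x) (unit_perm \<pi> x)" for \<mu>
      by (rule proj_eq_if_same_label) (simp_all add: unit_label_def)
    then have "Pstar (unit_graph ?t) x x = Pstar (unit_graph t) (unit_perm \<pi> x) (unit_perm \<pi> x)"
      using x by (simp add: Pstar_unit_graph[where t = t, OF assms] Pstar_unit_graph[where t = ?t, OF w'])
    moreover have "image_mset (Pstar (unit_graph ?t) x) (mset_set {..<24}) =
        image_mset (Pstar (unit_graph t) (unit_perm \<pi> x)) (mset_set {..<24})"
      using x by (intro Pstar_unit_graph_multiset[where t = ?t and t' = t, OF w' assms]) simp_all
    ultimately show "?inv ?t x = ?inv t (unit_perm \<pi> x)" by simp
  qed
  also have "\<dots> = image_mset (?inv t) (mset_set {..<24})"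
    by (rule image_mset_unit_perm[symmetric])
  finally show ?thesis
    by (simp add: F_weak_def Spec_unit_graph verts_unit_graph)
qed

section \<open>Separation by the strong invariant\<close>

text \<open>Two eigenvalues suffice for the separation: -2 on the diagonal detects prisms, and 9
  detects whether two vertices lie in the same pair.\<close>

lemma proj_entries:
  "proj t (-2) x x = (if t (x div 6) then 1 / 3 else 0)"
  "proj t 9 x y = (if x div 6 div 2 = y div 6 div 2 then 1 / 12 else 0)"
  by (simp_all add: proj_def unit_proj_def const_proj_def offset_def)

text \<open>The conditional expressions denote the joined unit: in \<open>t\<close> the pair of
  \<open>v\<close> has equal types, in \<open>t'\<close> every pair is mixed.\<close>

lemma F_strong_unit_graph_neq:
  assumes "w < 4" "t w" "v < 4" "t v = t (if even v then v + 1 else v - 1)"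
    and "w' < 4" "t' w'" "\<And>u. u < 4 \<Longrightarrow> t' u \<noteq> t' (if even u then u + 1 else u - 1)"
  shows "F_strong (unit_graph t) \<noteq> F_strong (unit_graph t')"
proof
  let ?inv = "\<lambda>t x. (Pstar (unit_graph t) x x,
    image_mset (\<lambda>y. (Pstar (unit_graph t) x y, Pstar (unit_graph t) y y)) (mset_set {..<24}))"
  assume "F_strong (unit_graph t) = F_strong (unit_graph t')"
  then have "image_mset (?inv t) (mset_set {..<24}) = image_mset (?inv t') (mset_set {..<24})"
    by (simp add: F_strong_def verts_unit_graph)
  from arg_cong[OF this, of set_mset] have "?inv t ` {..<24} = ?inv t' ` {..<24}"
    by (simp only: set_image_mset finite_set_mset_mset_set finite_lessThan)
  moreover have "?inv t (6 * v) \<in> ?inv t ` {..<24}"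
    using assms(3) by (intro imageI) simp
  ultimately have "?inv t (6 * v) \<in> ?inv t' ` {..<24}" by (simp only:)
  then obtain x where "x \<in> {..<24}" and x2: "?inv t (6 * v) = ?inv t' x"
    by (rule imageE)
  then have x: "x < 24" by simp
  note P = Pstar_unit_graph[where t = t, OF assms(1,2)] and P' = Pstar_unit_graph[where t = t', OF assms(5,6)]
  let ?u = "x div 6"
  define u' where "u' = (if even ?u then ?u + 1 else ?u - 1)"
  have u: "?u < 4" using x by auto
  then have u': "u' < 4" "u' div 2 = ?u div 2"
    using less_4_cases[OF u] by (auto simp: u'_def)
  \<comment> \<open>The unit \<open>u'\<close> joined to that of \<open>x\<close> has the other
    type. Its entry must recur around \<open>6 * v\<close> at some \<open>y\<close>; the eigenvalue
    9 puts \<open>y\<close> into the pair of \<open>v\<close>, where only the type of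
    \<open>v\<close> occurs.\<close>
  have "(Pstar (unit_graph t') x (6 * u'), Pstar (unit_graph t') (6 * u') (6 * u')) \<in>
      (\<lambda>y. (Pstar (unit_graph t') x y, Pstar (unit_graph t') y y)) ` {..<24}"
    using u' by (intro imageI) auto
  also have "\<dots> = (\<lambda>y. (Pstar (unit_graph t) (6 * v) y, Pstar (unit_graph t) y y)) ` {..<24}"
    using arg_cong[OF x2, of "\<lambda>p. set_mset (snd p)"]
    by (simp only: snd_conv set_image_mset finite_set_mset_mset_set finite_lessThan)
  finally obtain y where y: "y < 24"
    and eq: "Pstar (unit_graph t') x (6 * u') = Pstar (unit_graph t) (6 * v) y"
      "Pstar (unit_graph t') (6 * u') (6 * u') = Pstar (unit_graph t) y y"
    by auto
  have "proj t' 9 x (6 * u') = proj t 9 (6 * v) y" "proj t' (-2) (6 * u') (6 * u') = proj t (-2) y y"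
    using eq x y u' assms(3) by (simp_all add: P P')
  then have "v div 2 = y div 6 div 2" "t' u' = t (y div 6)"
    using u' by (simp_all add: proj_entries split: if_splits)
  moreover have "t v = t' ?u"
  proof -
    have "proj t (-2) (6 * v) (6 * v) = proj t' (-2) x x"
      using x x2 assms(3) by (simp add: P P')
    then show ?thesis by (simp add: proj_entries split: if_splits)
  qed
  moreover have "t (y div 6) = t v" if "v div 2 = y div 6 div 2"
  proof -
    have "y div 6 < 4" using y by auto
    then show ?thesis
      using that assms(4) less_4_cases[OF assms(3)] less_4_cases[of "y div 6"] by auto
  qed
  moreover have "t' ?u \<noteq> t' u'"
    using assms(7)[OF u] by (simp add: u'_def)
  ultimately show False by auto
qed

theorem theorem6p1:
  shows "(\<exists>G H. is_graph G \<and> is_graph H \<and> WL32 G = WL32 H \<and> F_strong G \<noteq> F_strong H) \<and>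
         (\<exists>G H. is_graph G \<and> is_graph H \<and> F_weak G = F_weak H \<and> F_strong G \<noteq> F_strong H)"
proof -
  \<comment> \<open>Units 2 and 3 are the prisms, so the pairs of \<open>?G\<close> are unmixed;
    exchanging units 1 and 3 mixes both pairs in \<open>?H\<close>.\<close>
  define \<pi> :: "nat \<Rightarrow> nat" where "\<pi> u = (if u = 1 then 3 else if u = 3 then 1 else u)" for u
  interpret unit_involution \<pi>
    by unfold_locales (auto simp: \<pi>_def)
  define t :: "nat \<Rightarrow> bool" where "t u \<longleftrightarrow> u \<ge> 2" for u
  let ?G = "unit_graph t" and ?H = "unit_graph (\<lambda>u. t (\<pi> u))"
  have "F_strong ?G \<noteq> F_strong ?H"
  \<comment> \<open>Unit 3 is a prism in \<open>?G\<close> and unit 2 in \<open>?H\<close>; unit 0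
    lies in an unmixed pair of \<open>?G\<close>.\<close>
  proof (rule F_strong_unit_graph_neq[of 3 _ 0 2])
    fix u :: nat assume "u < 4"
    then show "t (\<pi> u) \<noteq> t (\<pi> (if even u then u + 1 else u - 1))"
      by (drule_tac less_4_cases) (auto simp: t_def \<pi>_def)
  qed (simp_all add: t_def \<pi>_def)
  moreover have "WL32 ?G = WL32 ?H"
    by (rule WL32_unit_graph[symmetric])
  moreover have "F_weak ?G = F_weak ?H"
    by (rule F_weak_unit_graph[of 3, symmetric]) (simp_all add: t_def)
  ultimately show ?thesis
    using is_graph_unit_graph by blast
qed

end
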